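(* Let $\lambda = (h_1 +h_2 -l_1-l_2 -\alpha _1-\alpha _2+1 )/2$. The function $$g (x) = x^{-\alpha _1 } \sum _{n=0}^{\infty} (q^{1/2} x^{-1})^n \frac{ ( q^{\lambda +\alpha _1 } ; q )_n }{(q^{\alpha _1 -\alpha _2 +1 } ; q )_n } \sum _{k=0}^n \frac{(q^{ \lambda +\alpha _1 -h_2 +l_2 }; q)_k\, (q^{ \lambda +\alpha _1 -h_1 +l_1 } ;q)_{n-k }}{(q;q )_k (q;q)_{n-k}} (q^{l_1} t_1)^k (q ^{l_2}t_2 ) ^{n-k}$$ is a (formal) solution of the variant of the $q$-hypergeometric equation of degree two, i.e. of $$(x-q^{h_1 +1/2} t_1) (x - q^{h_2 +1/2} t_2)\, g(x/q) + q^{\alpha _1 +\alpha _2} (x - q^{l_1-1/2}t_1 ) (x - q^{l_2 -1/2} t_2)\, g(q x) -\big[ (q^{\alpha _1} +q^{\alpha _2} ) x^2 +E x + p ( q^{1/2}+ q^{-1/2}) t_1 t_2 \big]\, g(x) =0,$$ where $p= q^{(h_1 +h_2 + l_1 + l_2 +\alpha _1 +\alpha _2 )/2 }$ and $E= -p \{ (q^{- h_2 }+q^{-l_2 })t_1 + (q^{- h_1 }+ q^{- l_1 }) t_2 \}$.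
   Context: Here $q$ is a fixed nonzero complex number that is not a root of unity, with a fixed choice of $\log q$ so that $q^s=e^{s\log q}$; $h_1,h_2,l_1,l_2,\alpha_1,\alpha_2$ are complex parameters and $t_1,t_2$ are nonzero complex parameters, such that no denominator appearing vanishes. The $q$-Pochhammer symbol is $(a;q)_0=1$, $(a;q)_n=(1-a)(1-aq)\cdots(1-aq^{n-1})$ for $n\ge 1$. The power $x^{s}$ satisfies $(q^{\pm1}x)^{s}=q^{\pm s}x^{s}$. Infinite sums are treated formally and convergence is not discussed: here $g(x)$ is $x^{-\alpha_1}$ times a formal power series in $x^{-1}$, $g(x/q)$ and $g(qx)$ are defined termwise, and the equation is understood as the vanishing of the coefficient of every power of $x$ in $x^{\alpha_1}$ times the left-hand side. *)

theory Defs
  imports Complex_Main "HOL-Computational_Algebra.Formal_Laurent_Series"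
begin

text \<open>
  \<open>qpow L s\<close> is \<open>q\<^sup>s\<close> for the base \<open>q = exp L\<close>, where \<open>L\<close> is the chosen
  value of \<open>log q\<close> (not necessarily the principal one, so \<open>powr\<close> is not suitable).
\<close>

definition qpow :: "complex \<Rightarrow> complex \<Rightarrow> complex" where
  "qpow L s = exp (s * L)"

definition qpoch :: "complex \<Rightarrow> complex \<Rightarrow> nat \<Rightarrow> complex" where
  "qpoch a q n = (\<Prod>j<n. 1 - a * q ^ j)"

text \<open>
  A formal expression \<open>g(x) = x\<^sup>\<rho> (\<Sum>n. c\<^sub>n x\<^sup>-\<^sup>n)\<close> is represented by the exponent \<open>\<rho>\<close> together
  with the power series \<open>F = (\<Sum>n. c\<^sub>n u\<^sup>n)\<close> in \<open>u = x\<^sup>-\<^sup>1\<close>. As \<open>(q\<^sup>e x)\<^sup>s = q\<^sup>e\<^sup>s x\<^sup>s\<close>, the termwise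
  substitution \<open>x \<mapsto> q\<^sup>e x\<close> keeps \<open>\<rho>\<close> and multiplies the coefficient of \<open>x\<^bsup>\<rho> - n\<^esup>\<close> by
  \<open>q\<^bsup>e (\<rho> - n)\<^esup>\<close>. Thus \<open>qshift L \<rho> e F\<close> represents \<open>x\<^bsup>-\<rho>\<^esup> g(q\<^sup>e x)\<close>.
\<close>

definition qshift :: "complex \<Rightarrow> complex \<Rightarrow> complex \<Rightarrow> complex fps \<Rightarrow> complex fps" where
  "qshift L \<rho> e F = Abs_fps (\<lambda>n. qpow L (e * (\<rho> - of_nat n)) * fps_nth F n)"

text \<open>
  Laurent series are taken in \<open>u = x\<^sup>-\<^sup>1\<close>, so the variable \<open>x\<close> is \<open>u\<^sup>-\<^sup>1\<close>.
\<close>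

abbreviation xvar :: "complex fls" where
  "xvar \<equiv> fls_X_inv"

end

theory Submission
  imports Defs
begin

text \<open>
  Write \<open>g(x) = x\<^bsup>-\<alpha>1\<^esup> (\<Sum>n. g\<^sub>n x\<^bsup>-n\<^esup>)\<close>. The coefficients of the \<open>q\<close>-difference operator are
  quadratic polynomials in \<open>x\<close>, so the equation is a three-term recurrence for \<open>g\<^sub>n\<close>, \<open>g\<^bsub>n-1\<^esub>\<close>,
  \<open>g\<^bsub>n-2\<^esub>\<close>. Put \<open>A = q\<^bsup>\<lambda>+\<alpha>1\<^esup>\<close>, \<open>B = q\<^bsup>\<lambda>+\<alpha>1-h2+l2\<^esup>\<close>, \<open>C = q\<^bsup>\<lambda>+\<alpha>1-h1+l1\<^esup>\<close>,
  \<open>D = q\<^bsup>\<alpha>1-\<alpha>2+1\<^esup>\<close>, \<open>X = q\<^bsup>l1\<^esup> t\<^sub>1\<close>, \<open>Y = q\<^bsup>l2\<^esup> t\<^sub>2\<close>. Two observations give this recurrence.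

  The inner sum \<open>s\<^sub>n\<close> is the coefficient of \<open>z\<^sup>n\<close> in the product \<open>F\<close> of the two \<open>q\<close>-binomial
  series \<open>(BXz;q)\<^sub>\<infinity>/(Xz;q)\<^sub>\<infinity>\<close> and \<open>(CYz;q)\<^sub>\<infinity>/(Yz;q)\<^sub>\<infinity>\<close>. Hence
  \<open>(1 - BXz) (1 - CYz) F(qz) = (1 - Xz) (1 - Yz) F(z)\<close>, which is a three-term recurrence for
  \<open>s\<^sub>n\<close> (\<open>qbinomial_product_recurrence\<close>). As \<open>BC = D\<close>, its last coefficient contains the factor
  \<open>1 - D q\<^bsup>n-2\<^esup>\<close>, exactly what is needed to pass to the weighted coefficients
  \<open>g\<^sub>n = q\<^bsup>n/2\<^esup> (A;q)\<^sub>n / (D;q)\<^sub>n s\<^sub>n\<close> without leaving a denominator (\<open>weighted_recurrence\<close>).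

  On the other side, the three coefficients of the recurrence coming from the equation factor
  completely over the same quantities: with \<open>Q = q\<^bsup>n-1\<^esup>\<close> they are, up to the common
  nonzero factor \<open>q\<^bsup>\<alpha>2\<^esup> / (q Q)\<close>, the numbers \<open>(1 - q Q) (1 - D Q)\<close>,
  \<open>- q\<^bsup>1/2\<^esup> (1 - A Q) (X + Y - (BX + CY) Q)\<close> and \<open>q (1 - A Q) (1 - A Q/q) X Y\<close>
  (\<open>fls_nth_equation\<close>). So the two recurrences are the same.
\<close>

section \<open>Powers of q and q-shifted factorials\<close>

lemma qpow_nonzero [simp]: "qpow L s \<noteq> 0"
  by (simp add: qpow_def)

lemma qpow_add: "qpow L (a + b) = qpow L a * qpow L b"
  by (simp add: qpow_def exp_add algebra_simps)

lemma qpow_of_nat: "qpow L (of_nat n) = exp L ^ n"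
  by (simp add: qpow_def exp_of_nat_mult)

lemma qpow_minus: "qpow L (- s) = inverse (qpow L s)"
  by (simp add: qpow_def exp_minus)

lemma qpoch_0 [simp]: "qpoch a q 0 = 1"
  by (simp add: qpoch_def)

lemma qpoch_Suc: "qpoch a q (Suc n) = qpoch a q n * (1 - a * q ^ n)"
  by (simp add: qpoch_def)

lemma qpoch_q_q_nonzero:
  fixes q :: complex
  assumes "\<And>n. n > 0 \<Longrightarrow> q ^ n \<noteq> 1"
  shows "qpoch q q n \<noteq> 0"
proof -
  have "1 - q * q ^ j \<noteq> 0" for j
    using assms[of "Suc j"] by simp
  then show ?thesis by (simp add: qpoch_def)
qed

section \<open>Products of two q-binomial series\<close>

definition qbinomial_series :: "complex \<Rightarrow> complex \<Rightarrow> complex \<Rightarrow> complex fps" where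
  "qbinomial_series q a x = Abs_fps (\<lambda>n. qpoch a q n / qpoch q q n * x ^ n)"

text \<open>
  For \<open>\<phi>(z) = (axz;q)\<^sub>\<infinity>/(xz;q)\<^sub>\<infinity>\<close> the quotient \<open>\<phi>(qz)/\<phi>(z)\<close> telescopes to
  \<open>(1 - xz)/(1 - axz)\<close>. For formal series this is, on coefficients, the ratio
  \<open>(1 - q\<^bsup>n+1\<^esup>) \<phi>\<^bsub>n+1\<^esub> = x (1 - a q\<^sup>n) \<phi>\<^sub>n\<close> of consecutive terms.
\<close>

lemma qbinomial_series_dilation:
  fixes q a x :: complex
  assumes "\<And>n. n > 0 \<Longrightarrow> q ^ n \<noteq> 1"
  defines "\<phi> \<equiv> qbinomial_series q a x"
  shows "(1 - fps_const (a * x) * fps_X) * (\<phi> oo (fps_const q * fps_X))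
       = (1 - fps_const x * fps_X) * \<phi>"
proof (rule fps_ext)
  fix n
  show "fps_nth ((1 - fps_const (a * x) * fps_X) * (\<phi> oo (fps_const q * fps_X))) n
      = fps_nth ((1 - fps_const x * fps_X) * \<phi>) n"
  proof (cases n)
    case 0
    then show ?thesis by (simp add: fps_compose_linear algebra_simps)
  next
    case (Suc m)
    have nz: "qpoch q q m \<noteq> 0" "1 - q * q ^ m \<noteq> 0"
      using qpoch_q_q_nonzero[OF assms(1), of m] assms(1)[of "Suc m"] by auto
    have "(1 - q * q ^ m) * fps_nth \<phi> (Suc m) = x * (1 - a * q ^ m) * fps_nth \<phi> m"
      using nz by (simp add: \<phi>_def qbinomial_series_def qpoch_Suc)
    then show ?thesis
      by (simp add: Suc fps_compose_linear left_diff_distrib mult.assoc) (simp add: algebra_simps)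
  qed
qed

lemma qbinomial_product_dilation:
  fixes q a b x y :: complex
  assumes "\<And>n. n > 0 \<Longrightarrow> q ^ n \<noteq> 1"
  defines "F \<equiv> qbinomial_series q a x * qbinomial_series q b y"
  shows "(1 - fps_const (a * x) * fps_X) * (1 - fps_const (b * y) * fps_X)
           * (F oo (fps_const q * fps_X))
       = (1 - fps_const x * fps_X) * (1 - fps_const y * fps_X) * F"
proof -
  let ?z = "fps_const q * fps_X"
  let ?\<phi> = "qbinomial_series q a x" and ?\<psi> = "qbinomial_series q b y"
  have "F oo ?z = (?\<phi> oo ?z) * (?\<psi> oo ?z)"
    unfolding F_def by (rule fps_compose_mult_distrib) simp
  then have "(1 - fps_const (a * x) * fps_X) * (1 - fps_const (b * y) * fps_X) * (F oo ?z)
      = ((1 - fps_const (a * x) * fps_X) * (?\<phi> oo ?z))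
        * ((1 - fps_const (b * y) * fps_X) * (?\<psi> oo ?z))"
    by (simp only: mult_ac)
  also have "\<dots> = ((1 - fps_const x * fps_X) * ?\<phi>) * ((1 - fps_const y * fps_X) * ?\<psi>)"
    by (simp only: qbinomial_series_dilation[OF assms(1)])
  finally show ?thesis
    by (simp only: F_def mult_ac)
qed

text \<open>
  Coefficients are read off in the Laurent series, where they are indexed by integers and vanish at
  negative indices. A three-term recurrence then holds at every index, and its first two instances
  need no separate statement.
\<close>

lemma fls_nth_two_linear_factors:
  fixes F :: "complex fps"
  shows "fls_nth (fps_to_fls ((1 - fps_const a * fps_X) * (1 - fps_const b * fps_X) * F)) i
       = fls_nth (fps_to_fls F) i - (a + b) * fls_nth (fps_to_fls F) (i - 1)
         + a * b * fls_nth (fps_to_fls F) (i - 2)"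
proof -
  have "(1 - fps_const a * fps_X) * (1 - fps_const b * fps_X) * F
      = F - fps_const (a + b) * (fps_X * F) + fps_const (a * b) * (fps_X * (fps_X * F))"
    by (simp add: algebra_simps flip: fps_const_add fps_const_mult)
  then show ?thesis
    by (simp add: fls_times_fps_to_fls fls_X_times_conv_shift)
qed

lemma qbinomial_product_recurrence:
  fixes q a b x y :: complex and i :: int
  assumes "q \<noteq> 0" and "\<And>n. n > 0 \<Longrightarrow> q ^ n \<noteq> 1"
  defines "s \<equiv> fls_nth (fps_to_fls (qbinomial_series q a x * qbinomial_series q b y))"
    and "Q \<equiv> q powi (i - 1)"
  shows "(1 - q * Q) * s i
       = (x + y - (a * x + b * y) * Q) * s (i - 1) - x * y * (1 - a * b * (Q / q)) * s (i - 2)"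
proof -
  let ?F = "qbinomial_series q a x * qbinomial_series q b y"
  have dil: "fls_nth (fps_to_fls (?F oo (fps_const q * fps_X))) j = q powi j * s j" for j
    by (simp add: s_def fps_compose_linear power_int_def)
  have Q: "q powi i = q * Q" "q powi (i - 2) = Q / q"
    using \<open>q \<noteq> 0\<close> by (simp_all add: Q_def power_int_diff power2_eq_square)
  have "q powi i * s i - (a * x + b * y) * (q powi (i - 1) * s (i - 1))
          + a * x * (b * y) * (q powi (i - 2) * s (i - 2))
      = s i - (x + y) * s (i - 1) + x * y * s (i - 2)"
    using arg_cong[OF qbinomial_product_dilation[OF assms(2), of a x b y],
        of "\<lambda>f. fls_nth (fps_to_fls f) i"]
    unfolding fls_nth_two_linear_factors dil s_def[symmetric] .
  then show ?thesis
    unfolding Q Q_def[symmetric] by (simp add: algebra_simps)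
qed

section \<open>Coefficients of the equation\<close>

text \<open>
  Since \<open>x = u\<^bsup>-1\<^esup>\<close>, multiplication by \<open>x\<close> lowers the exponent of \<open>u\<close>, so the coefficients of \<open>f\<close>
  that contribute are those from index \<open>m\<close> upwards.
\<close>

lemma fls_nth_quadratic_times:
  fixes f :: "complex fls"
  shows "fls_nth ((xvar - fls_const a) * (xvar - fls_const b) * f) m
       = fls_nth f (m + 2) - (a + b) * fls_nth f (m + 1) + a * b * fls_nth f m"
proof -
  have "(xvar - fls_const a) * (xvar - fls_const b) * f
      = xvar * (xvar * f) - fls_const (a + b) * (xvar * f) + fls_const (a * b) * f"
    by (simp add: algebra_simps flip: fls_plus_const fls_const_mult_const)
  then show ?thesis
    by (simp add: fls_X_inv_times_conv_shift)
qed

lemma fls_nth_qshift: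
  "fls_nth (fps_to_fls (qshift L (- \<alpha>) (- 1) G)) i
     = qpow L \<alpha> * exp L powi i * fls_nth (fps_to_fls G) i"
  "fls_nth (fps_to_fls (qshift L (- \<alpha>) 1 G)) i
     = inverse (qpow L \<alpha>) * exp L powi (- i) * fls_nth (fps_to_fls G) i"
proof -
  have "qpow L (- 1 * (- \<alpha> - of_nat n)) = qpow L \<alpha> * exp L ^ n"
    and "qpow L (1 * (- \<alpha> - of_nat n)) = inverse (qpow L \<alpha>) * inverse (exp L ^ n)" for n
    using qpow_add[of L \<alpha> "of_nat n"] qpow_add[of L "- \<alpha>" "- of_nat n"]
    by (simp_all add: qpow_of_nat qpow_minus add.commute)
  then show "fls_nth (fps_to_fls (qshift L (- \<alpha>) (- 1) G)) i
      = qpow L \<alpha> * exp L powi i * fls_nth (fps_to_fls G) i"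
    and "fls_nth (fps_to_fls (qshift L (- \<alpha>) 1 G)) i
      = inverse (qpow L \<alpha>) * exp L powi (- i) * fls_nth (fps_to_fls G) i"
    unfolding qshift_def by (simp_all add: power_int_def power_inverse)
qed

section \<open>The recurrence with hypergeometric weights\<close>

text \<open>
  The weight satisfies \<open>(1 - D q\<^sup>k) w\<^bsub>k+1\<^esub> = r (1 - A q\<^sup>k) w\<^sub>k\<close>. Used once upwards for \<open>g\<^sub>i\<close> and once
  downwards for \<open>g\<^bsub>i-2\<^esub>\<close>, it makes each of the three terms a multiple of
  \<open>r (1 - A Q) w\<^bsub>i-1\<^esub>\<close>; the cofactor is the recurrence for \<open>s\<close>. At negative indices \<open>nat\<close> truncates and the relation between the weights
  fails, so \<open>i \<le> 0\<close> is a separate case; at \<open>i = 0\<close> the factor \<open>1 - q Q\<close> vanishes.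
\<close>

lemma weighted_recurrence:
  fixes q r A D x y u v :: complex and s g :: "int \<Rightarrow> complex" and i :: int
  defines "w \<equiv> \<lambda>n::nat. r ^ n * (qpoch A q n / qpoch D q n)"
    and "Q \<equiv> q powi (i - 1)"
  assumes q: "q \<noteq> 0"
    and D: "\<And>n. qpoch D q n \<noteq> 0"
    and neg: "\<And>j. j < 0 \<Longrightarrow> s j = 0"
    and g: "\<And>j. g j = w (nat j) * s j"
    and s: "(1 - q * Q) * s i
       = (x + y - (u * x + v * y) * Q) * s (i - 1) - x * y * (1 - D * (Q / q)) * s (i - 2)"
  shows "(1 - q * Q) * (1 - D * Q) * g i
       - r * (1 - A * Q) * (x + y - (u * x + v * y) * Q) * g (i - 1)
       + r\<^sup>2 * (1 - A * Q) * (1 - A * (Q / q)) * (x * y) * g (i - 2) = 0"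
proof (cases "i \<le> 0")
  case True
  have "(1 - q * Q) * g i = 0"
  proof (cases "i = 0")
    case True
    then show ?thesis using q by (simp add: Q_def power_int_minus)
  next
    case False
    then show ?thesis using True neg g by simp
  qed
  moreover have "g (i - 1) = 0" "g (i - 2) = 0"
    using True neg g by simp_all
  ultimately show ?thesis by auto
next
  case False
  define n where "n = nat (i - 1)"
  have i: "i = int (Suc n)" using False by (simp add: n_def)
  have Q: "Q = q ^ n" by (simp add: Q_def i)
  have step: "(1 - D * q ^ k) * w (Suc k) = r * (1 - A * q ^ k) * w k" for k
    using D[of k] D[of "Suc k"] by (simp add: w_def qpoch_Suc)
  have g1: "(1 - D * Q) * g i = r * (1 - A * Q) * w n * s i"
    using step[of n] unfolding g Q i by (simp add: mult.assoc[symmetric] del: of_nat_Suc)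
  have g2: "g (i - 1) = w n * s (i - 1)"
    unfolding g by (simp add: n_def)
  \<comment> \<open>For \<open>i = 1\<close> both sides vanish, because \<open>s\<close> and \<open>g\<close> are zero at \<open>- 1\<close>.\<close>
  have g3: "r * (1 - A * (Q / q)) * g (i - 2) = w n * (1 - D * (Q / q)) * s (i - 2)"
  proof (cases n)
    case 0
    then show ?thesis using neg g i by simp
  next
    case (Suc k)
    then have "Q / q = q ^ k" and "nat (i - 2) = k"
      using q i by (simp_all add: Q)
    then show ?thesis
      using arg_cong[OF step[of k], of "\<lambda>z. z * s (i - 2)"] unfolding g Suc
      by (simp only: mult_ac)
  qed
  have "(1 - q * Q) * (1 - D * Q) * g i
       - r * (1 - A * Q) * (x + y - (u * x + v * y) * Q) * g (i - 1)
       + r\<^sup>2 * (1 - A * Q) * (1 - A * (Q / q)) * (x * y) * g (i - 2)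
     = (1 - q * Q) * ((1 - D * Q) * g i)
       - r * (1 - A * Q) * (x + y - (u * x + v * y) * Q) * g (i - 1)
       + r * (1 - A * Q) * (x * y) * (r * (1 - A * (Q / q)) * g (i - 2))"
    by (simp add: power2_eq_square mult_ac)
  also have "\<dots> = r * (1 - A * Q) * w n * ((1 - q * Q) * s i
       - (x + y - (u * x + v * y) * Q) * s (i - 1) + x * y * (1 - D * (Q / q)) * s (i - 2))"
    unfolding g1 g2 g3 by (simp only: ring_distribs mult_ac)
  also have "\<dots> = 0"
    unfolding s by simp
  finally show ?thesis .
qed

section \<open>Factorisation of the recurrence belonging to the equation\<close>

text \<open>
  The coefficients of the equation are Laurent polynomials in \<open>Q\<close>, and each of them factors because
  the exponents in \<open>p\<close>, \<open>E\<close>, \<open>A\<close>, \<open>B\<close>, \<open>C\<close> match. For \<open>g\<^sub>i\<close> the roots \<open>q Q = 1\<close> and \<open>D Q = 1\<close>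
  reflect the exponents \<open>\<alpha>1\<close> and \<open>\<alpha>2\<close> at infinity; for \<open>g\<^bsub>i-1\<^esub>\<close> the parts with \<open>t1\<close> and \<open>t2\<close> have
  the roots \<open>1/A\<close>, \<open>1/B\<close> and \<open>1/A\<close>, \<open>1/C\<close>; for \<open>g\<^bsub>i-2\<^esub>\<close> the term \<open>q\<^bsup>1/2\<^esup> + q\<^bsup>-1/2\<^esup>\<close> makes the
  two roots \<open>1/A\<close> and \<open>q/A\<close>.
\<close>

lemma fls_nth_equation:
  fixes L h1 h2 l1 l2 \<alpha>1 \<alpha>2 t1 t2 p E :: complex and G :: "complex fps"
  defines "q \<equiv> exp L" and "r \<equiv> qpow L (1 / 2)"
    and "A \<equiv> qpow L ((h1 + h2 - l1 - l2 + \<alpha>1 - \<alpha>2 + 1) / 2)"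
    and "B \<equiv> qpow L ((h1 - h2 - l1 + l2 + \<alpha>1 - \<alpha>2 + 1) / 2)"
    and "C \<equiv> qpow L ((- h1 + h2 + l1 - l2 + \<alpha>1 - \<alpha>2 + 1) / 2)"
    and "D \<equiv> qpow L (\<alpha>1 - \<alpha>2 + 1)"
    and "x \<equiv> qpow L l1 * t1" and "y \<equiv> qpow L l2 * t2"
    and "g \<equiv> fls_nth (fps_to_fls G)"
  assumes p: "p = qpow L ((h1 + h2 + l1 + l2 + \<alpha>1 + \<alpha>2) / 2)"
    and E: "E = - p * ((qpow L (- h2) + qpow L (- l2)) * t1
                     + (qpow L (- h1) + qpow L (- l1)) * t2)"
  fixes i :: int
  defines "Q \<equiv> q powi (i - 1)"
  shows "fls_nth ((xvar - fls_const (qpow L (h1 + 1 / 2) * t1))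
           * (xvar - fls_const (qpow L (h2 + 1 / 2) * t2))
           * fps_to_fls (qshift L (- \<alpha>1) (- 1) G)
       + fls_const (qpow L (\<alpha>1 + \<alpha>2))
           * (xvar - fls_const (qpow L (l1 - 1 / 2) * t1))
           * (xvar - fls_const (qpow L (l2 - 1 / 2) * t2))
           * fps_to_fls (qshift L (- \<alpha>1) 1 G)
       - (fls_const (qpow L \<alpha>1 + qpow L \<alpha>2) * xvar ^ 2
            + fls_const E * xvar
            + fls_const (p * (qpow L (1 / 2) + qpow L (- 1 / 2)) * t1 * t2))
           * fps_to_fls G) (i - 2)
     = qpow L \<alpha>2 / (q * Q) *
        ((1 - q * Q) * (1 - D * Q) * g i
         - r * (1 - A * Q) * (x + y - (B * x + C * y) * Q) * g (i - 1)
         + r\<^sup>2 * (1 - A * Q) * (1 - A * (Q / q)) * (x * y) * g (i - 2))"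
    (is "fls_nth (?S + ?T - ?U) _ = _")
proof -
  let ?a = "qpow L \<alpha>1" and ?b = "qpow L \<alpha>2"
  have q: "q = qpow L 1" "q \<noteq> 0" and "Q \<noteq> 0"
    by (simp_all add: q_def qpow_def Q_def)
  have Q: "q powi i = q * Q" "q powi (i - 1) = Q" "q powi (i - 2) = Q / q"
    using \<open>q \<noteq> 0\<close> by (simp_all add: Q_def power_int_diff power2_eq_square)
  have shifts: "i - 2 + 2 = i" "i - 2 + 1 = i - 1" by simp_all

  have S: "fls_nth ?S (i - 2) = ?a * (q * Q) * g i
      - (qpow L (h1 + 1 / 2) * t1 + qpow L (h2 + 1 / 2) * t2) * (?a * Q * g (i - 1))
      + qpow L (h1 + 1 / 2) * t1 * (qpow L (h2 + 1 / 2) * t2) * (?a * (Q / q) * g (i - 2))"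
    unfolding fls_nth_quadratic_times fls_nth_qshift q_def[symmetric] g_def[symmetric]
    by (simp add: Q)
  have cancel: "?a * ?b * (inverse ?a * z2 * g2 - c1 * (inverse ?a * z1 * g1)
        + c0 * (inverse ?a * z0 * g0)) = ?b * (z2 * g2 - c1 * (z1 * g1) + c0 * (z0 * g0))"
    for z0 z1 z2 c0 c1 g0 g1 g2
    by (simp add: field_simps)
  have "?T = fls_const (qpow L (\<alpha>1 + \<alpha>2)) * ((xvar - fls_const (qpow L (l1 - 1 / 2) * t1))
           * (xvar - fls_const (qpow L (l2 - 1 / 2) * t2))
           * fps_to_fls (qshift L (- \<alpha>1) 1 G))"
    by (simp only: mult.assoc)
  then have T: "fls_nth ?T (i - 2) = ?b * (inverse (q * Q) * g i
      - (qpow L (l1 - 1 / 2) * t1 + qpow L (l2 - 1 / 2) * t2) * (inverse Q * g (i - 1))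
      + qpow L (l1 - 1 / 2) * t1 * (qpow L (l2 - 1 / 2) * t2) * (inverse (Q / q) * g (i - 2)))"
    by (simp only: fls_mult_const_nth fls_nth_quadratic_times fls_nth_qshift
          q_def[symmetric] g_def[symmetric] shifts power_int_minus Q qpow_add cancel)
  have "?U = fls_const (?a + ?b) * (xvar * (xvar * fps_to_fls G))
      + fls_const E * (xvar * fps_to_fls G)
      + fls_const (p * (qpow L (1 / 2) + qpow L (- 1 / 2)) * t1 * t2) * fps_to_fls G"
    by (simp only: power2_eq_square ring_distribs mult.assoc)
  then have U: "fls_nth ?U (i - 2) = (?a + ?b) * g i + E * g (i - 1)
      + p * (r + inverse r) * t1 * t2 * g (i - 2)"
    by (simp add: fls_X_inv_times_conv_shift g_def r_def qpow_minus del: fps_to_fls_nth)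

  have D: "?b * D = ?a * q"
    unfolding D_def q(1) qpow_add[symmetric]
    by (rule arg_cong[of _ _ "qpow L"]) (simp add: field_simps)
  have c2: "?a * (q * Q) + ?b * inverse (q * Q) - (?a + ?b)
      = ?b / (q * Q) * ((1 - q * Q) * (1 - D * Q))"
  proof -
    have "?b * ((1 - q * Q) * (1 - D * Q)) = (1 - q * Q) * (?b - ?b * D * Q)"
      by (simp add: algebra_simps)
    then have "?b / (q * Q) * ((1 - q * Q) * (1 - D * Q)) = (1 - q * Q) * (?b - ?a * q * Q) / (q * Q)"
      unfolding D by (metis times_divide_eq_left)
    also have "\<dots> = ?a * (q * Q) + ?b * inverse (q * Q) - (?a + ?b)"
      using \<open>q \<noteq> 0\<close> \<open>Q \<noteq> 0\<close> by (simp add: field_simps)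
    finally show ?thesis by simp
  qed

  \<comment> \<open>Up to a factor \<open>1/Q\<close>, a quadratic in \<open>Q\<close> with roots \<open>1/A\<close> and \<open>1/K\<close>, given that its coefficients match. It is
    applied once to the part with \<open>t1\<close> (\<open>K = B\<close>) and once to the part with \<open>t2\<close> (\<open>K = C\<close>).\<close>
  have linear_factor: "qpow L (l - 1 / 2) * ?b * inverse Q + qpow L (h + 1 / 2) * ?a * Q
        - p * (c + d) = ?b / (q * Q) * (r * (1 - A * Q) * (1 - K * Q) * qpow L l)"
    if "qpow L (l - 1 / 2) * ?b * A = p * c" "qpow L (l - 1 / 2) * ?b * K = p * d"
      "qpow L (l - 1 / 2) * ?b * (A * K) = qpow L (h + 1 / 2) * ?a" for l h c d K
  proof -
    have "qpow L l * r = q * qpow L (l - 1 / 2)"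
      unfolding r_def q(1) qpow_add[symmetric]
      by (rule arg_cong[of _ _ "qpow L"]) (simp add: field_simps)
    then have "?b / (q * Q) * (r * (1 - A * Q) * (1 - K * Q) * qpow L l)
        = inverse Q * (qpow L (l - 1 / 2) * ?b - qpow L (l - 1 / 2) * ?b * A * Q
            - qpow L (l - 1 / 2) * ?b * K * Q + qpow L (l - 1 / 2) * ?b * (A * K) * Q\<^sup>2)"
      using \<open>q \<noteq> 0\<close> \<open>Q \<noteq> 0\<close> by (simp add: field_simps power2_eq_square)
    then show ?thesis
      unfolding that using \<open>Q \<noteq> 0\<close> by (simp add: field_simps power2_eq_square)
  qed
  have t1: "qpow L (l1 - 1 / 2) * ?b * inverse Q + qpow L (h1 + 1 / 2) * ?a * Q
        - p * (qpow L (- l2) + qpow L (- h2))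
      = ?b / (q * Q) * (r * (1 - A * Q) * (1 - B * Q) * qpow L l1)"
    by (rule linear_factor; unfold A_def B_def p qpow_add[symmetric];
        rule arg_cong[of _ _ "qpow L"]; simp add: field_simps)
  have t2: "qpow L (l2 - 1 / 2) * ?b * inverse Q + qpow L (h2 + 1 / 2) * ?a * Q
        - p * (qpow L (- l1) + qpow L (- h1))
      = ?b / (q * Q) * (r * (1 - A * Q) * (1 - C * Q) * qpow L l2)"
    by (rule linear_factor; unfold A_def C_def p qpow_add[symmetric];
        rule arg_cong[of _ _ "qpow L"]; simp add: field_simps)
  have c1: "(qpow L (h1 + 1 / 2) * t1 + qpow L (h2 + 1 / 2) * t2) * (?a * Q)
      + ?b * ((qpow L (l1 - 1 / 2) * t1 + qpow L (l2 - 1 / 2) * t2) * inverse Q) + E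
      = ?b / (q * Q) * (r * (1 - A * Q) * (x + y - (B * x + C * y) * Q))"
    (is "?lhs = _")
  proof -
    have "?lhs = t1 * (qpow L (l1 - 1 / 2) * ?b * inverse Q + qpow L (h1 + 1 / 2) * ?a * Q
          - p * (qpow L (- l2) + qpow L (- h2)))
        + t2 * (qpow L (l2 - 1 / 2) * ?b * inverse Q + qpow L (h2 + 1 / 2) * ?a * Q
          - p * (qpow L (- l1) + qpow L (- h1)))"
      unfolding E by (simp add: algebra_simps)
    moreover have "t1 * (K * (r * (1 - A * Q) * (1 - B * Q) * qpow L l1))
        + t2 * (K * (r * (1 - A * Q) * (1 - C * Q) * qpow L l2))
        = K * (r * (1 - A * Q) * (x + y - (B * x + C * y) * Q))" for K
      unfolding x_def y_def by (simp add: algebra_simps)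
    ultimately show ?thesis
      by (simp only: t1 t2)
  qed

  have c0: "qpow L (h1 + 1 / 2) * t1 * (qpow L (h2 + 1 / 2) * t2) * (?a * (Q / q))
      + ?b * (qpow L (l1 - 1 / 2) * t1 * (qpow L (l2 - 1 / 2) * t2) * inverse (Q / q))
      - p * (r + inverse r) * t1 * t2
      = ?b / (q * Q) * (r\<^sup>2 * (1 - A * Q) * (1 - A * (Q / q)) * (x * y))"
  proof -
    let ?m = "?b * qpow L l1 * qpow L l2"
    \<comment> \<open>All three monomials are written through \<open>?m\<close>, \<open>A\<close> and \<open>r\<close>; then the factorisation is an
      identity of rational functions.\<close>
    have r: "r \<noteq> 0" "q = r\<^sup>2"
      by (simp_all add: r_def q qpow_def flip: exp_of_nat_mult)
    have m1: "?m * A = p * r"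
      unfolding A_def p r_def qpow_add[symmetric]
      by (rule arg_cong[of _ _ "qpow L"]) (simp add: field_simps)
    have m2: "qpow L (h1 + 1 / 2) * qpow L (h2 + 1 / 2) * ?a = ?m * A\<^sup>2"
      unfolding A_def power2_eq_square qpow_add[symmetric]
      by (rule arg_cong[of _ _ "qpow L"]) (simp add: field_simps)
    have "?m = q * qpow L (l1 - 1 / 2) * qpow L (l2 - 1 / 2) * ?b"
      unfolding q(1) qpow_add[symmetric]
      by (rule arg_cong[of _ _ "qpow L"]) (simp add: field_simps)
    then have m3: "?b * qpow L (l1 - 1 / 2) * qpow L (l2 - 1 / 2) = ?m / q"
      using \<open>q \<noteq> 0\<close> by (simp add: mult.assoc)
    have p': "p = ?m * A / r" using m1 r by simp
    have e1: "qpow L (h1 + 1 / 2) * t1 * (qpow L (h2 + 1 / 2) * t2) * (?a * (Q / q))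
        = (qpow L (h1 + 1 / 2) * qpow L (h2 + 1 / 2) * ?a) * (t1 * t2) * Q / q"
      by simp
    have e2: "?b * (qpow L (l1 - 1 / 2) * t1 * (qpow L (l2 - 1 / 2) * t2) * inverse (Q / q))
        = (?b * qpow L (l1 - 1 / 2) * qpow L (l2 - 1 / 2)) * (t1 * t2) * q / Q"
      by (simp add: field_simps)
    have e3: "?b / (q * Q) * (r\<^sup>2 * (1 - A * Q) * (1 - A * (Q / q)) * (x * y))
        = ?m * (t1 * t2) * (1 - A * Q) * (1 - A * (Q / q)) / Q"
    proof -
      have "?b / (q * Q) * (q * U * V * (x * y)) = ?m * (t1 * t2) * U * V / Q" for U V
        using \<open>q \<noteq> 0\<close> by (simp add: x_def y_def)
      then show ?thesis unfolding r(2) .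
    qed
    have e4: "M * A\<^sup>2 * T * Q / q + M / q * T * q / Q - M * A / r * (r + inverse r) * T
        = M * T * (1 - A * Q) * (1 - A * (Q / q)) / Q" for M T
      using r(1) \<open>Q \<noteq> 0\<close> unfolding r(2) by (simp add: field_simps power2_eq_square)
    show ?thesis
      unfolding e1 e2 e3 unfolding m2 m3 p'
      using e4[of ?m "t1 * t2"] by (simp only: mult.assoc)
  qed

  have "fls_nth (?S + ?T - ?U) (i - 2)
      = (?a * (q * Q) + ?b * inverse (q * Q) - (?a + ?b)) * g i
        - ((qpow L (h1 + 1 / 2) * t1 + qpow L (h2 + 1 / 2) * t2) * (?a * Q)
           + ?b * ((qpow L (l1 - 1 / 2) * t1 + qpow L (l2 - 1 / 2) * t2) * inverse Q) + E) * g (i - 1)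
        + (qpow L (h1 + 1 / 2) * t1 * (qpow L (h2 + 1 / 2) * t2) * (?a * (Q / q))
           + ?b * (qpow L (l1 - 1 / 2) * t1 * (qpow L (l2 - 1 / 2) * t2) * inverse (Q / q))
           - p * (r + inverse r) * t1 * t2) * g (i - 2)"
    unfolding fls_plus_nth fls_minus_nth S T U
    by (simp only: ring_distribs mult_ac add_ac diff_conv_add_uminus minus_mult_left[symmetric]
          minus_mult_right[symmetric] minus_add_distrib minus_minus)
  then show ?thesis
    unfolding c2 c1 c0 by (simp only: ring_distribs mult.assoc)
qed

theorem theorem3p2:
  fixes q L h1 h2 l1 l2 \<alpha>1 \<alpha>2 t1 t2 lam p E :: complex
    and G :: "complex fps"
  assumes logq: "exp L = q"
    and q_not_root_of_unity: "\<And>n. n > 0 \<Longrightarrow> q ^ n \<noteq> 1"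
    and t_nonzero: "t1 \<noteq> 0" "t2 \<noteq> 0"
    and denominators: "\<And>n. qpoch (qpow L (\<alpha>1 - \<alpha>2 + 1)) q n \<noteq> 0"
    and lam: "lam = (h1 + h2 - l1 - l2 - \<alpha>1 - \<alpha>2 + 1) / 2"
    and p: "p = qpow L ((h1 + h2 + l1 + l2 + \<alpha>1 + \<alpha>2) / 2)"
    and E: "E = - p * ((qpow L (- h2) + qpow L (- l2)) * t1
                     + (qpow L (- h1) + qpow L (- l1)) * t2)"
    and G: "G = Abs_fps (\<lambda>n. qpow L (1 / 2) ^ n
              * (qpoch (qpow L (lam + \<alpha>1)) q n / qpoch (qpow L (\<alpha>1 - \<alpha>2 + 1)) q n)
              * (\<Sum>k=0..n. (qpoch (qpow L (lam + \<alpha>1 - h2 + l2)) q k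
                            * qpoch (qpow L (lam + \<alpha>1 - h1 + l1)) q (n - k))
                          / (qpoch q q k * qpoch q q (n - k))
                          * (qpow L l1 * t1) ^ k * (qpow L l2 * t2) ^ (n - k)))"
  shows "(xvar - fls_const (qpow L (h1 + 1 / 2) * t1))
           * (xvar - fls_const (qpow L (h2 + 1 / 2) * t2))
           * fps_to_fls (qshift L (- \<alpha>1) (- 1) G)
       + fls_const (qpow L (\<alpha>1 + \<alpha>2))
           * (xvar - fls_const (qpow L (l1 - 1 / 2) * t1))
           * (xvar - fls_const (qpow L (l2 - 1 / 2) * t2))
           * fps_to_fls (qshift L (- \<alpha>1) 1 G)
       - (fls_const (qpow L \<alpha>1 + qpow L \<alpha>2) * xvar ^ 2
            + fls_const E * xvar
            + fls_const (p * (qpow L (1 / 2) + qpow L (- 1 / 2)) * t1 * t2))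
           * fps_to_fls G
       = 0" (is "?lhs = 0")
proof (rule fls_eqI)
  define B where "B = qpow L (lam + \<alpha>1 - h2 + l2)"
  define C where "C = qpow L (lam + \<alpha>1 - h1 + l1)"
  define D where "D = qpow L (\<alpha>1 - \<alpha>2 + 1)"
  define x where "x = qpow L l1 * t1"
  define y where "y = qpow L l2 * t2"
  define s where "s = fls_nth (fps_to_fls (qbinomial_series q B x * qbinomial_series q C y))"
  define g where "g = fls_nth (fps_to_fls G)"
  have q: "q \<noteq> 0" using logq by auto
  \<comment> \<open>By the choice of \<open>\<lambda>\<close>, the last coefficient of the recurrence for \<open>s\<close> contains a factor
    that cancels against the denominators \<open>(D;q)\<^sub>n\<close>.\<close>
  have BC: "B * C = D"
    unfolding B_def C_def D_def qpow_add[symmetric]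
    by (rule arg_cong[of _ _ "qpow L"]) (simp add: lam field_simps)
  have g: "g j = qpow L (1 / 2) ^ nat j
      * (qpoch (qpow L (lam + \<alpha>1)) q (nat j) / qpoch D q (nat j)) * s j" for j
    by (simp add: g_def s_def G D_def B_def C_def x_def y_def qbinomial_series_def fps_mult_nth
          mult_ac)
  fix m :: int
  \<comment> \<open>The coefficients of the equation are quadratic in \<open>x\<close>, so the coefficient of
    \<open>u\<^bsup>m\<^esup>\<close> is the instance of the recurrence with top index \<open>m + 2\<close>.\<close>
  define i where "i = m + 2"
  have exponents: "qpow L (lam + \<alpha>1) = qpow L ((h1 + h2 - l1 - l2 + \<alpha>1 - \<alpha>2 + 1) / 2)"
    "B = qpow L ((h1 - h2 - l1 + l2 + \<alpha>1 - \<alpha>2 + 1) / 2)"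
    "C = qpow L ((- h1 + h2 + l1 - l2 + \<alpha>1 - \<alpha>2 + 1) / 2)"
    by (simp_all add: B_def C_def lam qpow_def field_simps)
  have "(1 - q * q powi (i - 1)) * (1 - D * q powi (i - 1)) * g i
       - qpow L (1 / 2) * (1 - qpow L (lam + \<alpha>1) * q powi (i - 1))
          * (x + y - (B * x + C * y) * q powi (i - 1)) * g (i - 1)
       + (qpow L (1 / 2))\<^sup>2 * (1 - qpow L (lam + \<alpha>1) * q powi (i - 1))
          * (1 - qpow L (lam + \<alpha>1) * (q powi (i - 1) / q)) * (x * y) * g (i - 2) = 0"
  proof (rule weighted_recurrence[OF q _ _ g])
    show "qpoch D q n \<noteq> 0" for n
      using denominators by (simp add: D_def)
    show "s j = 0" if "j < 0" for j
      using that by (simp add: s_def)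
    show "(1 - q * q powi (i - 1)) * s i
        = (x + y - (B * x + C * y) * q powi (i - 1)) * s (i - 1)
          - x * y * (1 - D * (q powi (i - 1) / q)) * s (i - 2)"
      using qbinomial_product_recurrence[OF q q_not_root_of_unity, where a = B and b = C and x = x
          and y = y and i = i]
      by (simp only: s_def BC)
  qed
  then have "fls_nth ?lhs (i - 2) = 0"
    unfolding fls_nth_equation[OF p E] logq exponents D_def[symmetric] x_def[symmetric]
      y_def[symmetric] g_def[symmetric] by simp
  then show "fls_nth ?lhs m = fls_nth 0 m"
    by (simp add: i_def)
qed

end
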